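(* There is a $2$-connected subcubic outerplanar graph that is not packing $(1,1,3)$-colorable. Namely, let $G$ be the graph with vertex set $\{u_1,u_2,u_3,u_4,v_1,v_2\}$ obtained from the $4$-cycle $u_1u_2u_3u_4u_1$ by adding a path $u_1v_1u_2$ of length two from $u_1$ to $u_2$ and a path $u_3v_2u_4$ of length two from $u_3$ to $u_4$. Then $G$ is not packing $(1,1,3)$-colorable.
   Context: A graph is subcubic if its maximum degree is at most $3$. For a non-decreasing sequence $S=(s_1,\dots,s_k)$ of positive integers, a packing $S$-coloring of a graph $G$ is a partition of $V(G)$ into sets $V_1,\dots,V_k$ (some possibly empty) such that, for each $1\le i\le k$, the distance in $G$ between any two distinct vertices $x,y\in V_i$ is at least $s_i+1$. $G$ is packing $S$-colorable if it has a packing $S$-coloring. *)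

theory Defs
  imports "HOL-Analysis.Analysis" "Graph_Theory.Graph_Theory"
begin

text \<open>
  Finite simple undirected graphs are represented as in \<^theory>\<open>Graph_Theory.Pair_Digraph\<close>:
  \<^const>\<open>pair_graph\<close> holds of finite, loop-free, symmetric sets of pairs, so an undirected edge
  is a pair of opposite arcs.  The degree of a vertex is therefore its out-degree.
\<close>

definition subcubic :: "'a pair_pre_digraph \<Rightarrow> bool" where
  "subcubic G \<longleftrightarrow> (\<forall>v \<in> pverts G. out_degree (with_proj G) v \<le> 3)"

text \<open>
  \<^const>\<open>Digraph_Component.connected\<close> is graph connectivity; the unqualified name is
  topological connectedness or graph connectivity depending on the order of imports, and
  likewise for \<open>arc\<close> below.
\<close>

definition two_connected :: "'a pair_pre_digraph \<Rightarrow> bool" where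
  "two_connected G \<longleftrightarrow>
     card (pverts G) \<ge> 3 \<and>
     Digraph_Component.connected (with_proj G) \<and>
     (\<forall>v \<in> pverts G. Digraph_Component.connected (pre_digraph.del_vert (with_proj G) v))"

text \<open>
  A drawing places each vertex \<open>v\<close> at the point \<open>p v\<close> of the plane and draws each edge as a
  simple arc between its ends; both orientations of an edge trace the same arc.  The arcs meet
  the vertices and each other only at common ends.
\<close>

definition plane_drawing ::
  "'a pair_pre_digraph \<Rightarrow> ('a \<Rightarrow> complex) \<Rightarrow> ('a \<times> 'a \<Rightarrow> real \<Rightarrow> complex) \<Rightarrow> bool" where
  "plane_drawing G p \<gamma> \<longleftrightarrow>
     inj_on p (pverts G) \<and>
     (\<forall>(u, v) \<in> parcs G.
        Path_Connected.arc (\<gamma> (u, v)) \<and>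
        pathstart (\<gamma> (u, v)) = p u \<and> pathfinish (\<gamma> (u, v)) = p v \<and>
        path_image (\<gamma> (v, u)) = path_image (\<gamma> (u, v))) \<and>
     (\<forall>(u, v) \<in> parcs G. path_image (\<gamma> (u, v)) \<inter> p ` pverts G = {p u, p v}) \<and>
     (\<forall>(u, v) \<in> parcs G. \<forall>(x, y) \<in> parcs G. {u, v} \<noteq> {x, y} \<longrightarrow>
        path_image (\<gamma> (u, v)) \<inter> path_image (\<gamma> (x, y)) = p ` ({u, v} \<inter> {x, y}))"

definition drawing_set ::
  "'a pair_pre_digraph \<Rightarrow> ('a \<Rightarrow> complex) \<Rightarrow> ('a \<times> 'a \<Rightarrow> real \<Rightarrow> complex) \<Rightarrow> complex set" where
  "drawing_set G p \<gamma> = p ` pverts G \<union> (\<Union>e \<in> parcs G. path_image (\<gamma> e))"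

text \<open>
  For a finite graph the drawing is bounded, so its \<^const>\<open>outside\<close> is exactly the outer face.
\<close>

definition outerplanar :: "'a pair_pre_digraph \<Rightarrow> bool" where
  "outerplanar G \<longleftrightarrow>
     (\<exists>p \<gamma>. plane_drawing G p \<gamma> \<and> p ` pverts G \<subseteq> frontier (outside (drawing_set G p \<gamma>)))"

text \<open>Shortest-path distance; it is \<open>\<infinity>\<close> between different components.\<close>

definition graph_dist :: "'a pair_pre_digraph \<Rightarrow> 'a \<Rightarrow> 'a \<Rightarrow> ereal" where
  "graph_dist G x y = wf_digraph.\<mu> (with_proj G) (\<lambda>_. 1) x y"

text \<open>
  The sequence \<open>S\<close> is meant to be a non-decreasing list of positive integers; the definition
  itself makes sense for every list.  The classes are indexed from \<open>0\<close>.
\<close>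

definition packing_coloring :: "'a pair_pre_digraph \<Rightarrow> nat list \<Rightarrow> (nat \<Rightarrow> 'a set) \<Rightarrow> bool" where
  "packing_coloring G S V \<longleftrightarrow>
     (\<Union>i<length S. V i) = pverts G \<and>
     disjoint_family_on V {..<length S} \<and>
     (\<forall>i<length S. \<forall>x \<in> V i. \<forall>y \<in> V i. x \<noteq> y \<longrightarrow> ereal (real (S ! i + 1)) \<le> graph_dist G x y)"

definition packing_colorable :: "'a pair_pre_digraph \<Rightarrow> nat list \<Rightarrow> bool" where
  "packing_colorable G S \<longleftrightarrow> (\<exists>V. packing_coloring G S V)"

datatype vertex = U1 | U2 | U3 | U4 | V1 | V2

definition witness_edges :: "(vertex \<times> vertex) set" where
  "witness_edges =
     {(U1, U2), (U2, U3), (U3, U4), (U4, U1)} \<union> {(U1, V1), (V1, U2)} \<union> {(U3, V2), (V2, U4)}"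

definition witness_graph :: "vertex pair_pre_digraph" where
  "witness_graph =
     \<lparr> pverts = {U1, U2, U3, U4, V1, V2}, parcs = witness_edges \<union> witness_edges\<inverse> \<rparr>"

end

theory Submission
  imports Defs
begin

text \<open>
  The witness has diameter 3, so the class of separation 4 contains at most one vertex.  The other
  two classes are independent, so they miss a vertex of each triangle, while the triangles
  \<open>u\<^sub>1v\<^sub>1u\<^sub>2\<close> and \<open>u\<^sub>3v\<^sub>2u\<^sub>4\<close> are disjoint.  Outerplanarity is seen on a straight-line
  drawing in which \<open>v\<^sub>1, u\<^sub>2, u\<^sub>3, v\<^sub>2, u\<^sub>4, u\<^sub>1\<close> are the corners of a convex hexagon: each
  corner lies on a line that has the whole drawing on one side.
\<close>

section \<open>Connectivity and distance bounds in general graphs\<close>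

lemma (in wf_digraph) connected_if_spanning_path:
  assumes "verts G = set xs" "xs \<noteq> []" "successively (\<lambda>u v. u \<rightarrow>\<^bsub>G\<^esub> v) xs"
  shows "Digraph_Component.connected G"
proof -
  \<comment> \<open>\<open>connected\<close> means strong connectivity of the symmetric closure, so
    reachability is established in \<open>?M\<close>.\<close>
  let ?M = "with_proj (mk_symmetric G)"
  interpret M: wf_digraph ?M
    by unfold_locales (auto simp: mk_symmetric_def)
  have verts_M: "verts ?M = verts G"
    by (simp add: mk_symmetric_def)
  have dom: "u \<rightarrow>\<^bsub>?M\<^esub> v" if "u \<rightarrow>\<^bsub>G\<^esub> v" for u v
    using that by (auto simp: parcs_mk_symmetric)
  have from_hd: "hd ys \<rightarrow>\<^sup>*\<^bsub>?M\<^esub> v"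
    if "set ys \<subseteq> verts G" "successively (\<lambda>u v. u \<rightarrow>\<^bsub>G\<^esub> v) ys" "v \<in> set ys" for ys v
    using that
  proof (induction ys rule: induct_list012)
    case (3 a b ys)
    have ab: "a \<rightarrow>\<^bsub>?M\<^esub> b"
      using 3 dom by simp
    show ?case
    proof (cases "v = a")
      case True
      with 3 verts_M show ?thesis by simp
    next
      case False
      then have "b \<rightarrow>\<^sup>*\<^bsub>?M\<^esub> v" using 3 by simp
      with ab show ?thesis
        using M.adj_reachable_trans by simp
    qed
  qed (use verts_M in auto)
  have hd: "hd xs \<rightarrow>\<^sup>*\<^bsub>?M\<^esub> v" if "v \<in> verts G" for v
    using from_hd[of xs v] assms that by simp
  \<comment> \<open>By symmetry, \<open>u\<close> reaches the head of the list, and from there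
    \<open>v\<close> is reached.\<close>
  have "u \<rightarrow>\<^sup>*\<^bsub>?M\<^esub> v" if "u \<in> verts G" "v \<in> verts G" for u v
    using symmetric_reachable[OF symmetric_mk_symmetric hd[OF that(1)]] hd[OF that(2)]
    by (rule M.reachable_trans)
  then show ?thesis
    unfolding connected_def strongly_connected_def
    using assms verts_M by simp
qed

text \<open>The reflexive closure lets a walk pause, so the \<open>n\<close>-th power describes
  walks of length at most \<open>n\<close>. The distance is an infimum over walks with unit arc
  costs, so any such walk bounds it.\<close>

lemma (in pair_wf_digraph) graph_dist_le:
  assumes "x \<in> pverts G" "(x, y) \<in> ((parcs G)\<^sup>=) ^^ n"
  shows "graph_dist G x y \<le> ereal (real n)"
proof -
  have "\<exists>p. awalk x p y \<and> length p \<le> n"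
    using assms(2)
  proof (induction n arbitrary: y)
    case 0
    then show ?case
      using assms(1) by (intro exI[of _ "[]"]) (auto simp: awalk_Nil_iff)
  next
    case (Suc n)
    then obtain z where xz: "(x, z) \<in> ((parcs G)\<^sup>=) ^^ n" and z: "(z, y) \<in> (parcs G)\<^sup>="
      by (meson relpow_Suc_E)
    from Suc.IH[OF xz] obtain p where p: "awalk x p z" "length p \<le> n"
      by blast
    show ?case
    proof (cases "z = y")
      case True
      with p show ?thesis using le_SucI by blast
    next
      case False
      with z have e: "(z, y) \<in> parcs G" by simp
      then have "awalk z [(z, y)] y"
        using arc_fst_in_verts[OF e] arc_snd_in_verts[OF e] by (simp add: awalk_simps)
      with p have "awalk x (p @ [(z, y)]) y"
        by (simp add: awalk_appendI)
      with p show ?thesis by (intro exI[of _ "p @ [(z, y)]"]) simp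
    qed
  qed
  then obtain p where p: "awalk x p y" "length p \<le> n" by blast
  have "awalk_cost (\<lambda>_. 1) p = real (length p)"
    by (induction p) auto
  with min_cost_le_walk_cost[OF p(1), of "\<lambda>_. 1"] p(2) show ?thesis
    unfolding graph_dist_def by (metis ereal_less_eq(3) of_nat_le_iff order_trans)
qed

text \<open>This replaces the distance condition by a relation power, which can be evaluated on a
  concrete graph.\<close>

lemma packing_coloring_classD:
  assumes "pair_wf_digraph G" "packing_coloring G S V" "i < length S"
    and "x \<in> V i" "y \<in> V i" "(x, y) \<in> ((parcs G)\<^sup>=) ^^ (S ! i)"
  shows "x = y"
proof (rule ccontr)
  assume "x \<noteq> y"
  with assms have "ereal (real (S ! i + 1)) \<le> graph_dist G x y"
    unfolding packing_coloring_def by blast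
  also have "\<dots> \<le> ereal (real (S ! i))"
    using assms pair_wf_digraph.graph_dist_le[OF assms(1)] unfolding packing_coloring_def by blast
  finally show False by simp
qed

section \<open>The witness: degrees and 2-connectedness\<close>

lemma ex_vertex: "(\<exists>x. P x) \<longleftrightarrow> P U1 \<or> P U2 \<or> P U3 \<or> P U4 \<or> P V1 \<or> P V2"
  by (metis vertex.exhaust)

lemma pverts_witness: "pverts witness_graph = {U1, U2, U3, U4, V1, V2}"
  by (simp add: witness_graph_def)

lemma parcs_witness:
  "parcs witness_graph =
    {(U1, U2), (U2, U3), (U3, U4), (U4, U1), (U1, V1), (V1, U2), (U3, V2), (V2, U4),
     (U2, U1), (U3, U2), (U4, U3), (U1, U4), (V1, U1), (U2, V1), (V2, U3), (U4, V2)}"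
  by (auto simp: witness_graph_def witness_edges_def)

lemma pair_graph_witness: "pair_graph witness_graph"
proof
  show "symmetric (with_proj witness_graph)"
    unfolding symmetric_def by (rule symI) (auto simp: parcs_witness)
qed (auto simp: pverts_witness parcs_witness)

interpretation witness: pair_graph witness_graph
  by (rule pair_graph_witness)

lemma subcubic_witness: "subcubic witness_graph"
proof -
  have "out_arcs (with_proj witness_graph) v =
    Pair v ` (case v of U1 \<Rightarrow> {U2, U4, V1} | U2 \<Rightarrow> {U1, U3, V1} | U3 \<Rightarrow> {U2, U4, V2}
      | U4 \<Rightarrow> {U1, U3, V2} | V1 \<Rightarrow> {U1, U2} | V2 \<Rightarrow> {U3, U4})" for v
    by (cases v) (auto simp: out_arcs_def parcs_witness)
  then show ?thesis
    unfolding subcubic_def out_degree_def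
    by (auto simp: card_image inj_on_def split: vertex.split)
qed

text \<open>The graph has the Hamiltonian cycle U1, V1, U2, U3, V2, U4. Removing an edge or a vertex
  from this cycle leaves a spanning path.\<close>

lemma two_connected_witness: "two_connected witness_graph"
proof -
  have whole: "Digraph_Component.connected (with_proj witness_graph)"
    by (rule witness.connected_if_spanning_path[of "[U1, V1, U2, U3, V2, U4]"])
      (auto simp: pverts_witness parcs_witness)
  have "Digraph_Component.connected (pre_digraph.del_vert (with_proj witness_graph) v)" for v
  proof -
    let ?H = "pre_digraph.del_vert (with_proj witness_graph) v"
    \<comment> \<open>The Hamiltonian cycle, read from the successor of \<open>v\<close> to its
      predecessor.\<close>
    let ?xs = "case v of U1 \<Rightarrow> [V1, U2, U3, V2, U4] | V1 \<Rightarrow> [U2, U3, V2, U4, U1]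
      | U2 \<Rightarrow> [U3, V2, U4, U1, V1] | U3 \<Rightarrow> [V2, U4, U1, V1, U2]
      | V2 \<Rightarrow> [U4, U1, V1, U2, U3] | U4 \<Rightarrow> [U1, V1, U2, U3, V2]"
    show ?thesis
    proof (rule wf_digraph.connected_if_spanning_path[of ?H ?xs])
      show "wf_digraph ?H" by (rule witness.wf_digraph_del_vert)
    qed (cases v; auto simp: pre_digraph.del_vert_def pverts_witness parcs_witness
          arcs_ends_def arc_to_ends_def)+
  qed
  then show ?thesis
    using whole by (simp add: two_connected_def pverts_witness)
qed

section \<open>Outerplanarity of the witness\<close>

lemma in_frontier_outside_halfspace:
  fixes a :: "'a :: euclidean_space"
  assumes "S \<subseteq> {z. a \<bullet> z \<le> b}" "x \<in> S" "a \<bullet> x = b" "a \<noteq> 0"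
  shows "x \<in> frontier (outside S)"
proof -
  \<comment> \<open>The complement of a convex set containing \<open>S\<close> lies outside
    \<open>S\<close>. The closure of this open half-space includes the supporting hyperplane through
    \<open>x\<close>.\<close>
  have "{z. a \<bullet> z > b} \<subseteq> outside S"
    using outside_subset_convex[OF convex_halfspace_le assms(1)] by (auto simp: not_le)
  then have "closure {z. a \<bullet> z > b} \<subseteq> closure (outside S)"
    by (rule closure_mono)
  then have "x \<in> closure (outside S)"
    using assms by (auto simp: closure_halfspace_gt)
  moreover have "x \<notin> interior (outside S)"
    using assms(2) interior_subset outside_no_overlap[of S] by blast
  ultimately show ?thesis
    by (simp add: frontier_def)
qed

text \<open>With \<open>a < c\<close> the real part determines the segment parameter, which can
  therefore be eliminated. Cross-multiplying the slope equation avoids division.\<close>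

lemma closed_segment_Complex:
  assumes "a < c"
  shows "closed_segment (Complex a b) (Complex c d) =
    {z. a \<le> Re z \<and> Re z \<le> c \<and> (Im z - b) * (c - a) = (Re z - a) * (d - b)}" (is "?L = ?R")
proof
  show "?L \<subseteq> ?R"
  proof
    fix z assume "z \<in> ?L"
    then obtain u where u: "0 \<le> u" "u \<le> 1"
      and z: "z = (1 - u) *\<^sub>R Complex a b + u *\<^sub>R Complex c d"
      by (auto simp: in_segment)
    have Re: "Re z = a + u * (c - a)" and Im: "Im z = b + u * (d - b)"
      by (auto simp: z algebra_simps)
    have "u * (c - a) \<le> 1 * (c - a)"
      using u assms by (intro mult_right_mono) auto
    moreover have "0 \<le> u * (c - a)"
      using u assms by simp
    ultimately show "z \<in> ?R"
      unfolding mem_Collect_eq Re Im by (simp del: zero_le_mult_iff mult_le_cancel_right2)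
  qed
  show "?R \<subseteq> ?L"
  proof
    fix z assume z: "z \<in> ?R"
    define u where "u = (Re z - a) / (c - a)"
    have u: "0 \<le> u" "u \<le> 1"
      using z assms by (auto simp: u_def)
    have "Re z = a + u * (c - a)" "Im z = b + u * (d - b)"
      using z assms by (auto simp: u_def field_simps)
    then have "z = (1 - u) *\<^sub>R Complex a b + u *\<^sub>R Complex c d"
      by (auto simp: complex_eq_iff algebra_simps)
    with u show "z \<in> ?L"
      by (auto simp: in_segment)
  qed
qed

lemma closed_segment_Complex_vertical:
  assumes "b \<le> d"
  shows "closed_segment (Complex a b) (Complex a d) = {z. Re z = a \<and> b \<le> Im z \<and> Im z \<le> d}"
  using assms by (auto simp: closed_segment_same_Re closed_segment_eq_real_ivl)

text \<open>The four U vertices form a square, with V1 and V2 on the real axis to its left and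
  right. Every edge is vertical or has slope 0, 1 or -1, which keeps the segment equations
  simple.\<close>

definition position :: "vertex \<Rightarrow> complex" where
  "position v = (case v of U1 \<Rightarrow> Complex (-1) (-1) | U2 \<Rightarrow> Complex (-1) 1 | U3 \<Rightarrow> Complex 1 1
    | U4 \<Rightarrow> Complex 1 (-1) | V1 \<Rightarrow> Complex (-2) 0 | V2 \<Rightarrow> Complex 2 0)"

lemma Re_position [simp]:
  "Re (position v) = (case v of U1 \<Rightarrow> -1 | U2 \<Rightarrow> -1 | U3 \<Rightarrow> 1 | U4 \<Rightarrow> 1 | V1 \<Rightarrow> -2 | V2 \<Rightarrow> 2)"
  by (cases v) (simp_all add: position_def)

lemma Im_position [simp]:
  "Im (position v) = (case v of U1 \<Rightarrow> -1 | U2 \<Rightarrow> 1 | U3 \<Rightarrow> 1 | U4 \<Rightarrow> -1 | V1 \<Rightarrow> 0 | V2 \<Rightarrow> 0)"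
  by (cases v) (simp_all add: position_def)

text \<open>One orientation per edge: left to right, or upwards for vertical edges, to match the two
  general segment lemmas.\<close>

lemma witness_segments:
  "closed_segment (position U1) (position U2) = {z. Re z = -1 \<and> -1 \<le> Im z \<and> Im z \<le> 1}"
  "closed_segment (position U4) (position U3) = {z. Re z = 1 \<and> -1 \<le> Im z \<and> Im z \<le> 1}"
  "closed_segment (position U2) (position U3) = {z. Im z = 1 \<and> -1 \<le> Re z \<and> Re z \<le> 1}"
  "closed_segment (position U1) (position U4) = {z. Im z = -1 \<and> -1 \<le> Re z \<and> Re z \<le> 1}"
  "closed_segment (position V1) (position U1) = {z. Im z = -2 - Re z \<and> -2 \<le> Re z \<and> Re z \<le> -1}"
  "closed_segment (position V1) (position U2) = {z. Im z = 2 + Re z \<and> -2 \<le> Re z \<and> Re z \<le> -1}"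
  "closed_segment (position U3) (position V2) = {z. Im z = 2 - Re z \<and> 1 \<le> Re z \<and> Re z \<le> 2}"
  "closed_segment (position U4) (position V2) = {z. Im z = Re z - 2 \<and> 1 \<le> Re z \<and> Re z \<le> 2}"
  by (auto simp: position_def closed_segment_Complex closed_segment_Complex_vertical)

lemma inj_position: "inj position"
proof (rule injI)
  fix x y assume "position x = position y"
  then show "x = y" by (cases x; cases y) (auto simp: complex_eq_iff)
qed

lemma plane_drawing_witness:
  "plane_drawing witness_graph position (\<lambda>(u, v). linepath (position u) (position v))"
proof -
  \<comment> \<open>These reverse exactly the eight orientations absent from
    \<open>witness_segments\<close>.\<close>
  note commute = closed_segment_commute[of "position U2" "position U1"]
    closed_segment_commute[of "position U3" "position U4"]
    closed_segment_commute[of "position U3" "position U2"]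
    closed_segment_commute[of "position U4" "position U1"]
    closed_segment_commute[of "position U1" "position V1"]
    closed_segment_commute[of "position U2" "position V1"]
    closed_segment_commute[of "position V2" "position U3"]
    closed_segment_commute[of "position V2" "position U4"]
  have on_segment: "position w \<in> closed_segment (position u) (position v) \<longleftrightarrow> w = u \<or> w = v"
    if "(u, v) \<in> parcs witness_graph" for u v w
    using that by (cases w) (auto simp: parcs_witness commute witness_segments)
  \<comment> \<open>Stated for a single point \<open>z\<close>, so that each of the 16 by 16 pairs
    of arcs becomes a linear arithmetic problem in \<open>Re z\<close> and
    \<open>Im z\<close>.\<close>
  have common: "z = position u \<and> u \<in> {x, y} \<or> z = position v \<and> v \<in> {x, y}"
    if "(u, v) \<in> parcs witness_graph" "(x, y) \<in> parcs witness_graph" "{u, v} \<noteq> {x, y}"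
      "z \<in> closed_segment (position u) (position v)"
      "z \<in> closed_segment (position x) (position y)" for u v x y z
    using that unfolding parcs_witness
    by (elim insertE emptyE Pair_inject;
        simp add: commute witness_segments complex_eq_iff doubleton_eq_iff; linarith?)
  have crossings: "closed_segment (position u) (position v) \<inter> closed_segment (position x) (position y)
      = position ` ({u, v} \<inter> {x, y})"
    if "(u, v) \<in> parcs witness_graph" "(x, y) \<in> parcs witness_graph" "{u, v} \<noteq> {x, y}" for u v x y
    using common[OF that] by auto
  have vertices: "closed_segment (position u) (position v) \<inter> position ` pverts witness_graph
      = {position u, position v}" if "(u, v) \<in> parcs witness_graph" for u v
    using that on_segment[OF that] witness.arc_fst_in_verts[OF that] witness.arc_snd_in_verts[OF that]
    by auto
  have "position u \<noteq> position v" if "(u, v) \<in> parcs witness_graph" for u v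
    using that inj_position witness.no_loops' by (auto dest: injD)
  moreover have "inj_on position (pverts witness_graph)"
    by (rule inj_on_subset[OF inj_position subset_UNIV])
  ultimately show ?thesis
    by (simp add: plane_drawing_def Ball_def arc_linepath vertices crossings
        closed_segment_commute insert_commute)
qed

lemma outerplanar_witness: "outerplanar witness_graph"
proof -
  let ?\<gamma> = "\<lambda>(u, v). linepath (position u) (position v)"
  let ?D = "drawing_set witness_graph position ?\<gamma>"
  \<comment> \<open>A half-plane is convex, so it contains every edge whose ends it
    contains.\<close>
  have subset: "?D \<subseteq> {z. a \<bullet> z \<le> b}" if "\<And>v. a \<bullet> position v \<le> b" for a b
    using that closed_segment_subset[OF _ _ convex_halfspace_le, of _ a b]
    by (fastforce simp: drawing_set_def)
  have "position v \<in> frontier (outside ?D)" for v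
  proof -
    \<comment> \<open>Outward normal of a supporting line at \<open>v\<close>: the lines Re = -2 and
      Re = 2 for V1 and V2, Im = -1 and Im = 1 for the corners of the square.\<close>
    define a where "a = (case v of V1 \<Rightarrow> -1 | V2 \<Rightarrow> 1 | U1 \<Rightarrow> -\<i> | U4 \<Rightarrow> -\<i> | _ \<Rightarrow> \<i>)"
    show ?thesis
    proof (rule in_frontier_outside_halfspace)
      show "?D \<subseteq> {z. a \<bullet> z \<le> a \<bullet> position v}"
      proof (rule subset)
        show "a \<bullet> position w \<le> a \<bullet> position v" for w
          by (cases v; cases w) (simp_all add: a_def inner_complex_def)
      qed
      show "position v \<in> ?D"
        by (cases v) (simp_all add: drawing_set_def pverts_witness)
      show "a \<noteq> 0"
        by (cases v) (simp_all add: a_def)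
    qed simp
  qed
  with plane_drawing_witness show ?thesis
    unfolding outerplanar_def by blast
qed

section \<open>Packing colorings of the witness\<close>

lemma witness_diameter: "(x, y) \<in> ((parcs witness_graph)\<^sup>=) ^^ 3"
  \<comment> \<open>Unfolding the power gives existential statements about intermediate vertices,
    which \<open>ex_vertex\<close> makes finite. The exponent 3 is attained by V1 and V2.\<close>
  by (cases x; cases y)
    (simp_all add: numeral_3_eq_3 relcomp_unfold ex_vertex parcs_witness)

lemma not_packing_colorable_witness: "\<not> packing_colorable witness_graph [1, 1, 3]"
proof
  assume "packing_colorable witness_graph [1, 1, 3]"
  then obtain V where V: "packing_coloring witness_graph [1, 1, 3] V"
    by (auto simp: packing_colorable_def)
  note same_class = packing_coloring_classD[OF witness.pair_wf_digraph_axioms V]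
  \<comment> \<open>The first two entries are 1, so the relation power is adjacency or
    equality.\<close>
  have indep: "x = y" if "i < 2" "x \<in> V i" "y \<in> V i" "(x, y) \<in> parcs witness_graph" for i x y
    using same_class[of i x y] that by (auto simp: less_2_cases_iff)
  \<comment> \<open>The entry at index 2 is 3, which equals the diameter.\<close>
  have singleton: "x = y" if "x \<in> V 2" "y \<in> V 2" for x y
    using same_class[of 2 x y] that witness_diameter by simp
  have cover: "x \<in> V 0 \<or> x \<in> V 1 \<or> x \<in> V 2" for x
  proof -
    have "(\<Union>i<3. V i) = {U1, U2, U3, U4, V1, V2}"
      using V by (simp add: packing_coloring_def pverts_witness eval_nat_numeral)
    then have "x \<in> (\<Union>i<3. V i)"
      by (cases x) simp_all
    then show ?thesis
      by (auto simp: numeral_3_eq_3 numeral_2_eq_2 lessThan_Suc)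
  qed
  \<comment> \<open>Pigeonhole: otherwise two of the three mutually adjacent vertices would share
    one of the two independent classes.\<close>
  have triangle: "x \<in> V 2 \<or> y \<in> V 2 \<or> z \<in> V 2"
    if "x \<noteq> y" "y \<noteq> z" "x \<noteq> z" "{(x, y), (y, z), (x, z)} \<subseteq> parcs witness_graph" for x y z
    using that cover[of x] cover[of y] cover[of z]
      indep[of 0] indep[of 1] by (metis insert_subset pos2 one_less_numeral_iff semiring_norm(76))
  have "U1 \<in> V 2 \<or> U2 \<in> V 2 \<or> V1 \<in> V 2"
    by (rule triangle) (auto simp: parcs_witness)
  moreover have "U3 \<in> V 2 \<or> U4 \<in> V 2 \<or> V2 \<in> V 2"
    by (rule triangle) (auto simp: parcs_witness)
  ultimately show False
    using singleton by blast
qed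

theorem mainTheorem7:
  shows "pair_graph witness_graph \<and>
         two_connected witness_graph \<and>
         subcubic witness_graph \<and>
         outerplanar witness_graph \<and>
         \<not> packing_colorable witness_graph [1, 1, 3]"
  using pair_graph_witness two_connected_witness subcubic_witness outerplanar_witness
    not_packing_colorable_witness by blast

end
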